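(* (i) For all $p\in\mathbb{N}\cup\{0\}$, $n\in\mathbb{N}$, $\alpha\in[0,1]$, all real $r\ge 1$ and all $z\in\mathbb{C}$ with $|z|\le r$, one has $|G_n^\alpha(e_p;z)|\le r^p$. (ii) Let $R>1$, let $f(z)=\sum_{p=0}^\infty c_p z^p$ for all $|z|<R$ (so $f$ is analytic in $D_R$), and let $1\le r<R$. Then for all $|z|\le r$, $n\in\mathbb{N}$ and $\alpha\in[0,1]$, $$|G_n^\alpha(f;z)-f(z)|\le \frac{C_r(f)}{n},\qquad\text{where}\quad C_r(f)=2\sum_{p=2}^\infty |c_p|\,p(p-1)\,r^p<\infty .$$
   Context: $\mathbb{N}=\{1,2,3,\dots\}$; $e_p(z)=z^p$ (with $e_0=1$); $D_R=\{z\in\mathbb{C}:|z|<R\}$. For $0\le k\le n$ let $p_{n,k}(t)=\binom{n}{k}t^k(1-t)^{n-k}$. For $\alpha\in[0,1]$ the $\alpha$-Bernstein polynomials are $q_{1,0}^\alpha(z)=1-z$, $q_{1,1}^\alpha(z)=z$ and, for $n\ge2$, $0\le k\le n$, $$q_{n,k}^\alpha(z)=\left[\binom{n-2}{k}(1-\alpha)z+\binom{n-2}{k-2}(1-\alpha)(1-z)+\binom{n}{k}\alpha z(1-z)\right]z^{k-1}(1-z)^{n-k-1},$$ where $\binom{m}{j}=0$ if $j<0$ or $j>m$, and the expression is understood as a polynomial in $z$ after cancellation (e.g. $q_{n,0}^\alpha(z)=(1-\alpha)(1-z)^{n-1}+\alpha(1-z)^n$ and $q_{n,n}^\alpha(z)=(1-\alpha)z^{n-1}+\alpha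 z^n$). For $n\in\mathbb{N}$, $\alpha\in[0,1]$, $z\in\mathbb{C}$ and $f$ a complex-valued analytic function in $D_R$ with $R>1$, the complex genuine $\alpha$-Bernstein-Durrmeyer operator is $$G_n^\alpha(f;z)=q_{n,0}^\alpha(z)f(0)+q_{n,n}^\alpha(z)f(1)+(n-1)\sum_{k=1}^{n-1}q_{n,k}^\alpha(z)\int_0^1 p_{n-2,k-1}(t)f(t)\,dt$$ (the sum is empty for $n=1$). *)

theory Defs
  imports "HOL-Analysis.Analysis"
begin

text \<open>
  For \<open>n \<ge> 2\<close> the defining formula has the common factor \<open>z powi (k - 1) * (1 - z) powi (n - k - 1)\<close>
  with possibly negative exponents and is read as a polynomial after cancellation. Here that factor is
  multiplied into each summand. Where \<open>n - k - 1\<close> would be truncated, the binomial coefficient in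
  front of it vanishes; the test \<open>k < 2\<close> implements \<open>(m choose j) = 0\<close> for \<open>j < 0\<close>. Agreement with
  the factored formula is \<open>alpha_bernstein_factored\<close>. Only \<open>1 \<le> n\<close> and \<open>k \<le> n\<close> are relevant.
\<close>

definition alpha_bernstein :: "real \<Rightarrow> nat \<Rightarrow> nat \<Rightarrow> complex \<Rightarrow> complex" where
  "alpha_bernstein \<alpha> n k z =
     (if n = 1 then (if k = 0 then 1 - z else z)
      else of_nat ((n - 2) choose k) * (1 - of_real \<alpha>) * z ^ k * (1 - z) ^ (n - k - 1)
         + (if k < 2 then 0
            else of_nat ((n - 2) choose (k - 2)) * (1 - of_real \<alpha>) * z ^ (k - 1) * (1 - z) ^ (n - k))
         + of_nat (n choose k) * of_real \<alpha> * z ^ k * (1 - z) ^ (n - k))"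

lemma alpha_bernstein_factored:
  assumes "2 \<le> n" "k \<le> n" "z \<noteq> 0" "z \<noteq> 1"
  shows "alpha_bernstein \<alpha> n k z =
    (of_nat ((n - 2) choose k) * (1 - of_real \<alpha>) * z
     + (if k < 2 then 0 else of_nat ((n - 2) choose (k - 2))) * (1 - of_real \<alpha>) * (1 - z)
     + of_nat (n choose k) * of_real \<alpha> * z * (1 - z))
    * z powi (int k - 1) * (1 - z) powi (int n - int k - 1)"
proof -
  have z1: "1 - z \<noteq> 0" using assms by simp
  have A: "z ^ k = z * z powi (int k - 1)"
    using power_int_add_1'[of z "int k - 1"] assms by simp
  have B: "(1 - z) ^ (n - k) = (1 - z) * (1 - z) powi (int n - int k - 1)"
    using power_int_add_1'[of "1 - z" "int n - int k - 1"] z1 assms(2)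
    by (simp flip: of_nat_diff power_int_of_nat)
  have C: "z ^ (k - 1) = z powi (int k - 1)" if "\<not> k < 2"
    using that by (simp flip: power_int_of_nat add: of_nat_diff)
  have D: "(1 - z) ^ (n - k - 1) = (1 - z) powi (int n - int k - 1)" if "k < n"
    using that by (simp flip: power_int_of_nat add: of_nat_diff diff_diff_eq add.commute)
  have E: "(n - 2) choose k = 0" if "\<not> k < n"
    using that assms by (simp add: binomial_eq_0)
  have F: "(if k < 2 then 0 else a * z ^ (k - 1) * b) = (if k < 2 then 0 else a) * z powi (int k - 1) * b"
    for a b :: complex
    using C by simp
  show ?thesis
  proof (cases "k < n")
    case True
    then show ?thesis using assms unfolding alpha_bernstein_def F A B D[OF True]
      by (auto simp: algebra_simps)
  next
    case False
    then show ?thesis using assms unfolding alpha_bernstein_def F A B E[OF False]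
      by (auto simp: algebra_simps)
  qed
qed

lemma alpha_bernstein_0:
  "2 \<le> n \<Longrightarrow> alpha_bernstein \<alpha> n 0 z = (1 - of_real \<alpha>) * (1 - z) ^ (n - 1) + of_real \<alpha> * (1 - z) ^ n"
  by (simp add: alpha_bernstein_def)

lemma alpha_bernstein_n:
  "2 \<le> n \<Longrightarrow> alpha_bernstein \<alpha> n n z = (1 - of_real \<alpha>) * z ^ (n - 1) + of_real \<alpha> * z ^ n"
  by (simp add: alpha_bernstein_def binomial_eq_0)

definition genuine_alpha_BD :: "nat \<Rightarrow> real \<Rightarrow> (complex \<Rightarrow> complex) \<Rightarrow> complex \<Rightarrow> complex" where
  "genuine_alpha_BD n \<alpha> f z =
     alpha_bernstein \<alpha> n 0 z * f 0 + alpha_bernstein \<alpha> n n z * f 1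
     + (of_nat n - 1) * (\<Sum>k = 1..n - 1. alpha_bernstein \<alpha> n k z *
         integral {0..1} (\<lambda>t. of_real (Bernstein (n - 2) (k - 1) t) * f (of_real t)))"

end

theory Submission
  imports Defs
begin

text \<open>
  By the Beta integral, \<open>G\<^sub>n(e\<^sub>p)\<close> is the \<open>\<alpha>\<close>-Bernstein polynomial of the values
  \<open>(k + p - 1 choose p) / (n + p - 1 choose p)\<close>. Expanding these by Vandermonde's identity shows that
  \<open>G\<^sub>n(e\<^sub>p)\<close> is a convex combination of \<open>1, z, \<dots>, z\<^sup>p\<close>; this gives (i), and also
  \<open>\<bar>G\<^sub>n(e\<^sub>p; z) - z\<^sup>p\<bar> \<le> 2 (1 - a\<^sub>p) r\<^sup>p\<close> where \<open>a\<^sub>p\<close> is the coefficient of \<open>z\<^sup>p\<close>. The latter is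
  smallest for \<open>\<alpha> = 0\<close>, where it equals \<open>(n - 2 choose p - 1) / (n + p - 2 choose p - 1)\<close> and hence is at least
  \<open>1 - p (p - 1) / n\<close>. Summing over the power series of \<open>f\<close> gives (ii).
\<close>

section \<open>Binomial moments of the Bernstein basis\<close>

text \<open>After \<open>(n choose k) * (k choose j) = (n choose j) * ((n - j) choose (k -
  j))\<close>, what remains is the expansion of \<open>(z + (1 - z)) ^ (n - j) = 1\<close>. These
  are the factorial moments of a binomial law, as polynomial identities.\<close>

lemma sum_Bernstein_binomial:
  fixes z :: "'a :: comm_ring_1"
  shows "(\<Sum>k\<le>n. of_nat (n choose k) * z ^ k * (1 - z) ^ (n - k) * of_nat (k choose j)) =
    of_nat (n choose j) * z ^ j"
proof (cases "j \<le> n")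
  case True
  have "(\<Sum>k\<le>n. of_nat (n choose k) * z ^ k * (1 - z) ^ (n - k) * of_nat (k choose j)) =
      (\<Sum>k\<in>{j..n}. of_nat (n choose k) * z ^ k * (1 - z) ^ (n - k) * of_nat (k choose j))"
    by (rule sum.mono_neutral_right) (auto simp: binomial_eq_0)
  also have "\<dots> = (\<Sum>i\<le>n - j. of_nat (n choose j) * z ^ j *
      (of_nat ((n - j) choose i) * z ^ i * (1 - z) ^ (n - j - i)))"
  proof (rule sum.reindex_bij_witness[of _ "\<lambda>i. i + j" "\<lambda>k. k - j"])
    fix k assume k: "k \<in> {j..n}"
    then obtain i where i: "k = i + j" by (metis atLeastAtMost_iff le_add_diff_inverse2)
    have "(n choose k) * (k choose j) = (n choose j) * ((n - j) choose i)"
      using choose_mult[of j k n] k i by simp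
    then have "of_nat (n choose k) * of_nat (k choose j) =
        (of_nat (n choose j) * of_nat ((n - j) choose i) :: 'a)"
      by (metis of_nat_mult)
    moreover have "of_nat (n choose k) * z ^ k * (1 - z) ^ (n - k) * of_nat (k choose j) =
        (of_nat (n choose k) * of_nat (k choose j)) * z ^ k * (1 - z) ^ (n - k)"
      by (simp only: mult_ac)
    ultimately show "of_nat (n choose j) * z ^ j *
      (of_nat ((n - j) choose (k - j)) * z ^ (k - j) * (1 - z) ^ (n - j - (k - j))) =
      of_nat (n choose k) * z ^ k * (1 - z) ^ (n - k) * of_nat (k choose j)"
      using i by (simp add: power_add mult_ac add.commute)
  qed (use True in auto)
  also have "\<dots> = of_nat (n choose j) * z ^ j"
    using binomial_ring[of z "1 - z" "n - j"] by (simp flip: sum_distrib_left)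
  finally show ?thesis .
qed (auto simp: binomial_eq_0 intro!: sum.neutral)

text \<open>Vandermonde expresses \<open>(k + m) choose p\<close> through the
  \<open>k choose j\<close>, to which the moments above apply. The resulting coefficients of
  \<open>z ^ j\<close> are natural numbers.\<close>

lemma sum_Bernstein_binomial_shift:
  fixes z :: "'a :: comm_ring_1"
  shows "(\<Sum>k\<le>n. of_nat (n choose k) * z ^ k * (1 - z) ^ (n - k) * of_nat ((k + m) choose p)) =
    (\<Sum>j\<le>p. of_nat (n choose j) * of_nat (m choose (p - j)) * z ^ j)"
proof -
  have "(\<Sum>k\<le>n. of_nat (n choose k) * z ^ k * (1 - z) ^ (n - k) * of_nat ((k + m) choose p)) =
      (\<Sum>k\<le>n. \<Sum>j\<le>p. of_nat (m choose (p - j)) *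
        (of_nat (n choose k) * z ^ k * (1 - z) ^ (n - k) * of_nat (k choose j)))"
    unfolding vandermonde[symmetric] by (simp add: sum_distrib_left sum_distrib_right mult_ac)
  also have "\<dots> = (\<Sum>j\<le>p. of_nat (m choose (p - j)) *
      (\<Sum>k\<le>n. of_nat (n choose k) * z ^ k * (1 - z) ^ (n - k) * of_nat (k choose j)))"
    by (subst sum.swap) (simp add: sum_distrib_left)
  finally show ?thesis
    unfolding sum_Bernstein_binomial by (simp add: mult_ac)
qed

section \<open>The operator on monomials as an \<alpha>-Bernstein sum\<close>

lemma has_integral_power_mult_power:
  "((\<lambda>t::real. t ^ a * (1 - t) ^ b) has_integral fact a * fact b / fact (a + b + 1)) {0..1}"
proof -
  have "Beta (real a + 1) (real b + 1) = fact a * fact b / fact (a + b + 1)"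
    using Gamma_fact[of a, where 'a = real] Gamma_fact[of b, where 'a = real]
      Gamma_fact[of "a + b + 1", where 'a = real]
    by (simp add: Beta_def add_ac)
  \<comment> \<open>The open interval enters because \<open>powr\<close> and \<open>^\<close> agree
    only for a positive base: \<open>0 powr 0 = 0\<close>.\<close>
  then have "((\<lambda>t. t powr real a * (1 - t) powr real b) has_integral
      fact a * fact b / fact (a + b + 1)) {0<..<1}"
    using has_integral_Beta_real[of "real a + 1" "real b + 1"]
    by (simp add: has_integral_Icc_iff_Ioo)
  then have "((\<lambda>t::real. t ^ a * (1 - t) ^ b) has_integral
      fact a * fact b / fact (a + b + 1)) {0<..<1}"
    by (rule has_integral_eq[rotated]) (simp add: powr_realpow)
  then show ?thesis by (simp add: has_integral_Icc_iff_Ioo)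
qed

text \<open>The integral is a Beta integral with natural exponents. The factor
  \<open>of_nat n - 1\<close> completes \<open>fact (n - 2)\<close> to \<open>fact (n - 1)\<close>,
  which makes the factorials combine into a quotient of two binomials.\<close>

lemma Bernstein_moment:
  assumes "1 \<le> k" "k < n"
  shows "(of_nat n - 1) * integral {0..1}
      (\<lambda>t. of_real (Bernstein (n - 2) (k - 1) t) * of_real t ^ p) =
    (of_nat ((k + p - 1) choose p) / of_nat ((n + p - 1) choose p) :: complex)"
proof -
  obtain a where a: "k = Suc a" using assms by (cases k) auto
  obtain b where b: "n = a + b + 2" using assms a 
    by (intro that[of "n - a - 2"]) simp
  have "((\<lambda>t. of_nat ((a + b) choose a) * (t ^ (a + p) * (1 - t) ^ b)) has_integral
      of_nat ((a + b) choose a) * (fact (a + p) * fact b / fact (a + p + b + 1) :: real)) {0..1}"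
    by (intro has_integral_mult_right has_integral_power_mult_power)
  then have "((\<lambda>t. complex_of_real (of_nat ((a + b) choose a) * (t ^ (a + p) * (1 - t) ^ b))) has_integral
      of_real (of_nat ((a + b) choose a) * (fact (a + p) * fact b / fact (a + p + b + 1)))) {0..1}"
    by (rule has_integral_of_real)
  then have "integral {0..1} (\<lambda>t. of_real (Bernstein (n - 2) (k - 1) t) * of_real t ^ p) =
      complex_of_real (of_nat ((a + b) choose a) * (fact (a + p) * fact b / fact (a + p + b + 1)))"
    by (intro integral_unique) (simp add: Bernstein_def a b power_add mult_ac)
  moreover have "real (a + b + 1) * fact (a + b) = fact (a + b + 1)" by simp
  then have "real (a + b + 1) * (of_nat ((a + b) choose a) *
        (fact (a + p) * fact b / fact (a + p + b + 1))) =
      of_nat ((a + p) choose p) / of_nat ((a + b + 1 + p) choose p)"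
    by (simp add: binomial_fact add_ac field_simps del: fact_Suc of_nat_Suc of_nat_add)
  moreover have "of_nat n - 1 = complex_of_real (real (a + b + 1))" by (simp add: b)
  moreover have "k + p - 1 = a + p" "n + p - 1 = a + b + 1 + p" by (simp_all add: a b)
  ultimately show ?thesis
    by (metis of_real_divide of_real_mult of_real_of_nat_eq)
qed

text \<open>The quotient from \<open>Bernstein_moment\<close> also gives the endpoint values: it is
  \<open>0 ^ p\<close> at \<open>k = 0\<close> and \<open>1\<close> at \<open>k = n\<close>. Hence
  the two boundary terms join the sum.\<close>

lemma genuine_alpha_BD_monomial:
  assumes "1 \<le> n"
  shows "genuine_alpha_BD n \<alpha> (\<lambda>w. w ^ p) z =
    (\<Sum>k\<le>n. alpha_bernstein \<alpha> n k z * of_nat ((k + p - 1) choose p)) / of_nat ((n + p - 1) choose p)"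
proof -
  let ?d = "of_nat ((n + p - 1) choose p) :: complex"
  have d: "?d \<noteq> 0"
    using assms by (auto simp: binomial_eq_0_iff)
  have e: "{..n} = insert 0 (insert n {1..n - 1})" using assms by auto
  have "(of_nat n - 1) * (\<Sum>k = 1..n - 1. alpha_bernstein \<alpha> n k z *
         integral {0..1} (\<lambda>t. of_real (Bernstein (n - 2) (k - 1) t) * of_real t ^ p)) =
      (\<Sum>k = 1..n - 1. alpha_bernstein \<alpha> n k z * of_nat ((k + p - 1) choose p)) / ?d"
    unfolding sum_distrib_left sum_divide_distrib
    using Bernstein_moment[of _ n p]
    by (intro sum.cong) (auto simp: mult.left_commute[of "of_nat n - 1"])
  \<comment> \<open>For \<open>p = 0\<close> truncated subtraction yields
    \<open>0 choose 0 = 1\<close>; otherwise the numerator is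
    \<open>(p - 1) choose p = 0\<close>.\<close>
  moreover have "0 ^ p = (of_nat ((0 + p - 1) choose p) :: complex) / ?d"
    by (cases p) (auto simp: binomial_eq_0)
  ultimately show ?thesis
    using assms d unfolding e genuine_alpha_BD_def
    by (simp add: add_divide_distrib)
qed

text \<open>Reduction to classical Bernstein sums: the two summands weighted by
  \<open>1 - \<alpha>\<close> are basis polynomials of degree \<open>N\<close>, one multiplied by
  \<open>1 - z\<close>, the other by \<open>z\<close> with its index shifted by 2.\<close>

lemma sum_alpha_bernstein:
  "(\<Sum>k\<le>N + 2. alpha_bernstein \<alpha> (N + 2) k z * g k) =
    (1 - of_real \<alpha>) *
      ((1 - z) * (\<Sum>k\<le>N. of_nat (N choose k) * z ^ k * (1 - z) ^ (N - k) * g k) +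
       z * (\<Sum>k\<le>N. of_nat (N choose k) * z ^ k * (1 - z) ^ (N - k) * g (k + 2))) +
    of_real \<alpha> * (\<Sum>k\<le>N + 2. of_nat ((N + 2) choose k) * z ^ k * (1 - z) ^ (N + 2 - k) * g k)"
proof -
  have "(\<Sum>k\<le>N + 2. of_nat (N choose k) * z ^ k * (1 - z) ^ (N + 1 - k) * g k) =
      (\<Sum>k\<le>N. of_nat (N choose k) * z ^ k * (1 - z) ^ (N + 1 - k) * g k)"
    by (rule sum.mono_neutral_right) (auto simp: binomial_eq_0)
  also have "\<dots> = (1 - z) * (\<Sum>k\<le>N. of_nat (N choose k) * z ^ k * (1 - z) ^ (N - k) * g k)"
    by (auto simp: sum_distrib_left Suc_diff_le intro!: sum.cong)
  finally have 1: "(\<Sum>k\<le>N + 2. of_nat (N choose k) * z ^ k * (1 - z) ^ (N + 1 - k) * g k) = \<dots>" .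
  have "(\<Sum>k\<le>N + 2. (if k < 2 then 0
      else of_nat (N choose (k - 2)) * z ^ (k - 1) * (1 - z) ^ (N + 2 - k)) * g k) =
      (\<Sum>k\<in>{2..N+2}. of_nat (N choose (k - 2)) * z ^ (k - 1) * (1 - z) ^ (N + 2 - k) * g k)"
    by (rule sum.mono_neutral_cong_right) auto
  also have "\<dots> = (\<Sum>k\<le>N. z * (of_nat (N choose k) * z ^ k * (1 - z) ^ (N - k) * g (k + 2)))"
    by (rule sum.reindex_bij_witness[of _ "\<lambda>k. k + 2" "\<lambda>k. k - 2"])
      (auto simp: numeral_2_eq_2 Suc_diff_Suc simp flip: power_Suc)
  finally have 2: "(\<Sum>k\<le>N + 2. (if k < 2 then 0
      else of_nat (N choose (k - 2)) * z ^ (k - 1) * (1 - z) ^ (N + 2 - k)) * g k) =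
      z * (\<Sum>k\<le>N. of_nat (N choose k) * z ^ k * (1 - z) ^ (N - k) * g (k + 2))"
    by (simp add: sum_distrib_left)
  show ?thesis
    unfolding 1[symmetric] 2[symmetric] distrib_left[of "1 - of_real \<alpha>"]
      sum_distrib_left[of "1 - of_real \<alpha>"] sum_distrib_left[of "of_real \<alpha>"] sum.distrib[symmetric]
    by (rule sum.cong) (auto simp: alpha_bernstein_def algebra_simps)
qed

section \<open>Convex combinations of monomials\<close>

text \<open>Since \<open>1 \<le> r\<close>, every \<open>z ^ j\<close> with \<open>j \<le> p\<close>
  is bounded by \<open>r ^ p\<close>. In the difference, the lower monomials and the defect of
  \<open>z ^ p\<close> both carry total weight \<open>1 - a p\<close>, whence the factor 2.\<close>

lemma norm_convex_monomials_le:
  fixes z :: complex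
  assumes "\<And>j. 0 \<le> a j" "sum a {..p} = 1" "norm z \<le> r" "1 \<le> r"
  shows "norm (\<Sum>j\<le>p. of_real (a j) * z ^ j) \<le> r ^ p"
    and "norm ((\<Sum>j\<le>p. of_real (a j) * z ^ j) - z ^ p) \<le> 2 * (1 - a p) * r ^ p"
proof -
  have pw: "norm (z ^ j) \<le> r ^ p" if "j \<le> p" for j
  proof -
    have "norm (z ^ j) \<le> r ^ j" using assms by (simp add: norm_power power_mono)
    also have "\<dots> \<le> r ^ p" using that assms by (intro power_increasing)
    finally show ?thesis .
  qed
  have le: "norm (\<Sum>j\<in>A. of_real (a j) * z ^ j) \<le> sum a A * r ^ p" if "A \<subseteq> {..p}" for A
    unfolding sum_distrib_right
    by (rule sum_norm_le) (use that pw assms(1) in \<open>auto simp: norm_mult intro!: mult_mono\<close>)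
  show "norm (\<Sum>j\<le>p. of_real (a j) * z ^ j) \<le> r ^ p"
    using le[of "{..p}"] assms by simp
  have s: "sum a {..<p} = 1 - a p"
    using assms(2) by (simp flip: lessThan_Suc_atMost)
  moreover have "0 \<le> sum a {..<p}" using assms by (intro sum_nonneg)
  ultimately have "norm (of_real (1 - a p) * z ^ p) \<le> (1 - a p) * r ^ p"
    using pw[of p] unfolding norm_mult norm_of_real by (intro mult_mono) auto
  moreover have "norm (\<Sum>j<p. of_real (a j) * z ^ j) \<le> (1 - a p) * r ^ p"
    using le[of "{..<p}"] s by (simp add: subset_iff)
  moreover have eq: "(\<Sum>j\<le>p. of_real (a j) * z ^ j) - z ^ p =
      (\<Sum>j<p. of_real (a j) * z ^ j) - of_real (1 - a p) * z ^ p"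
    by (simp add: algebra_simps flip: lessThan_Suc_atMost)
  ultimately show "norm ((\<Sum>j\<le>p. of_real (a j) * z ^ j) - z ^ p) \<le> 2 * (1 - a p) * r ^ p"
    using norm_triangle_ineq4[of "\<Sum>j<p. of_real (a j) * z ^ j" "of_real (1 - a p) * z ^ p"]
    unfolding eq by linarith
qed

section \<open>The coefficients for \<alpha> = 0 and their leading term\<close>

text \<open>By induction: from \<open>m\<close> to \<open>Suc m\<close> the ratio
  \<open>(N choose m) / ((N + m + 1) choose m)\<close> gains the factor
  \<open>(N - m) / (N + m + 2)\<close>. Clearing denominators keeps the case \<open>N < m\<close>
  meaningful.\<close>

lemma binomial_ratio_lower_bound:
  "(real N + 2 - real m * (real m + 1)) * real ((N + m + 1) choose m) \<le> (real N + 2) * real (N choose m)"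
proof (induction m)
  case (Suc m)
  have A: "real (Suc m) * real (N choose Suc m) = (real N - real m) * real (N choose m)"
    using arg_cong[OF Suc_times_binomial[of m N], of real] by (simp add: algebra_simps)
  have B: "real (Suc m) * real ((N + Suc m + 1) choose Suc m) =
      (real N + real m + 2) * real ((N + m + 1) choose m)"
    using arg_cong[OF Suc_times_binomial[of m "N + m + 1"], of real] by (simp add: algebra_simps)
  show ?case
  proof (cases "m \<le> N")
    case True
    define B where "B = real ((N + m + 1) choose m)"
    have "(real N + 2 - (real m + 1) * (real m + 2)) * (real N + real m + 2) * B \<le>
       (real N - real m) * ((real N + 2 - real m * (real m + 1)) * B)"
    proof -
      \<comment> \<open>The gap equals \<open>2 * m * (m + 1) * (m + 2)\<close>, independently of
        \<open>N\<close>.\<close>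
      have "(real N - real m) * (real N + 2 - real m * (real m + 1)) -
        (real N + 2 - (real m + 1) * (real m + 2)) * (real N + real m + 2) = 2 * (real m ^ 3 + 3 * real m ^ 2 + 2 * real m)"
        by (simp add: algebra_simps power2_eq_square power3_eq_cube)
      then have "(real N + 2 - (real m + 1) * (real m + 2)) * (real N + real m + 2) \<le>
        (real N - real m) * (real N + 2 - real m * (real m + 1))"
        by (smt (verit) of_nat_0_le_iff zero_le_power mult_nonneg_nonneg)
      moreover have "0 \<le> B" by (simp add: B_def)
      ultimately show ?thesis by (metis mult.assoc mult_right_mono)
    qed
    also have "\<dots> \<le> (real N - real m) * ((real N + 2) * real (N choose m))"
      using Suc True unfolding B_def by (intro mult_left_mono) auto
    finally have "real (Suc m) * ((real N + 2 - real (Suc m) * (real (Suc m) + 1)) * real ((N + Suc m + 1) choose Suc m))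
      \<le> real (Suc m) * ((real N + 2) * real (N choose Suc m))"
      unfolding mult.left_commute[of "real (Suc m)"] A B by (simp add: B_def mult_ac add_ac)
    then show ?thesis by (rule mult_left_le_imp_le) simp
  next
    case False
    \<comment> \<open>For \<open>N < m\<close> the right-hand binomial vanishes, so it suffices that
      the left factor is nonpositive.\<close>
    then have "real N + 2 \<le> real (Suc m) * 1 + 1" by simp
    also have "\<dots> \<le> real (Suc m) * (real (Suc m) + 1)"
      by (simp add: algebra_simps)
    finally have "(real N + 2 - real (Suc m) * (real (Suc m) + 1)) * real ((N + Suc m + 1) choose Suc m) \<le> 0"
      by (intro mult_nonpos_nonneg) auto
    then show ?thesis using False by (simp add: binomial_eq_0)
  qed
qed simp


text \<open>
  Up to the normalising factor \<open>(N + m + 2 choose m + 1)\<close>, the coefficient of \<open>z\<^sup>j\<close> in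
  \<open>G\<^sub>n(e\<^sub>p; z)\<close> for \<open>\<alpha> = 0\<close>, \<open>n = N + 2\<close> and \<open>p = m + 1\<close>.
\<close>

definition alpha0_coeff :: "nat \<Rightarrow> nat \<Rightarrow> nat \<Rightarrow> nat" where
  "alpha0_coeff N m j = (N choose j) * (m choose (Suc m - j)) +
     (if j = 0 then 0 else (N choose (j - 1)) * ((Suc m choose (Suc m - j)) + (m choose (Suc m - j))))"

text \<open>The factor \<open>1 - z\<close> introduces negative terms. They are absorbed by Pascal's
  rule used twice: \<open>((m + 2) choose Suc i) - (m choose Suc i) = (Suc m choose i) + (m choose
  i)\<close>. This is why the coefficients are nonnegative.\<close>

lemma sum_alpha0_coeff:
  fixes z :: "'a :: comm_ring_1"
  shows "(\<Sum>j\<le>Suc m. of_nat (alpha0_coeff N m j) * z ^ j) =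
    (1 - z) * (\<Sum>j\<le>Suc m. of_nat (N choose j) * of_nat (m choose (Suc m - j)) * z ^ j) +
    z * (\<Sum>j\<le>Suc m. of_nat (N choose j) * of_nat ((m + 2) choose (Suc m - j)) * z ^ j)"
proof -
  let ?X = "\<Sum>j\<le>Suc m. of_nat (N choose j) * of_nat (m choose (Suc m - j)) * z ^ j"
  let ?W = "\<lambda>j. of_nat (N choose j) * of_nat ((Suc m choose (m - j)) + (m choose (m - j))) * z ^ Suc j"
  have "(\<Sum>j\<le>Suc m. of_nat (alpha0_coeff N m j) * z ^ j) = ?X + (\<Sum>j\<le>m. ?W j)"
    unfolding sum.atMost_Suc_shift
    by (simp add: alpha0_coeff_def algebra_simps flip: sum.distrib)
  also have "(\<Sum>j\<le>m. ?W j) =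
      (\<Sum>j\<le>m. of_nat (N choose j) * of_nat ((m + 2) choose (Suc m - j)) * z ^ Suc j -
        of_nat (N choose j) * of_nat (m choose (Suc m - j)) * z ^ Suc j)"
    by (rule sum.cong) (auto simp: Suc_diff_le algebra_simps)
  \<comment> \<open>Both sums may be extended to \<open>Suc m\<close>, as their terms of degree
    \<open>m + 2\<close> coincide and cancel.\<close>
  also have "\<dots> = z * (\<Sum>j\<le>Suc m. of_nat (N choose j) * of_nat ((m + 2) choose (Suc m - j)) * z ^ j) - z * ?X"
    by (simp add: sum_subtractf sum_distrib_left algebra_simps)
  finally show ?thesis by (simp add: algebra_simps)
qed

text \<open>At \<open>z = 1\<close> the part with \<open>1 - z\<close> drops out and Vandermonde
  remains. The evaluation is done in \<open>int\<close> because the identity involves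
  subtraction.\<close>

lemma sum_alpha0_coeff_1: "(\<Sum>j\<le>Suc m. alpha0_coeff N m j) = (N + m + 2) choose Suc m"
proof -
  have "int (\<Sum>j\<le>Suc m. alpha0_coeff N m j) = int (\<Sum>j\<le>Suc m. (N choose j) * ((m + 2) choose (Suc m - j)))"
    using sum_alpha0_coeff[of N m "1::int"] by simp
  then show ?thesis
    unfolding vandermonde of_nat_eq_iff by (simp add: add_ac)
qed

text \<open>After multiplication by \<open>Suc m\<close>, coefficient and normaliser acquire the
  same factor \<open>N + m + 2\<close>. The normalised leading coefficient is thus exactly the ratio
  bounded in \<open>binomial_ratio_lower_bound\<close>.\<close>

lemma alpha0_coeff_lead:
  "(real N + 2 - real (Suc m) * real m) * real ((N + m + 2) choose Suc m) \<le>
    (real N + 2) * real (alpha0_coeff N m (Suc m))"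
proof -
  have lead: "alpha0_coeff N m (Suc m) = (N choose Suc m) + 2 * (N choose m)"
    by (simp add: alpha0_coeff_def)
  have a: "real (Suc m) * real (alpha0_coeff N m (Suc m)) = (real N + real m + 2) * real (N choose m)"
    using arg_cong[OF Suc_times_binomial[of m N], of real] unfolding lead by (simp add: algebra_simps)
  have b: "real (Suc m) * real ((N + m + 2) choose Suc m) =
      (real N + real m + 2) * real ((N + m + 1) choose m)"
    using arg_cong[OF Suc_times_binomial[of m "N + m + 1"], of real] by (simp add: algebra_simps)
  have "(real N + real m + 2) * ((real N + 2 - real m * (real m + 1)) * real ((N + m + 1) choose m)) \<le>
      (real N + real m + 2) * ((real N + 2) * real (N choose m))"
    by (intro mult_left_mono binomial_ratio_lower_bound) simp
  then have "real (Suc m) * ((real N + 2 - real (Suc m) * real m) * real ((N + m + 2) choose Suc m)) \<le>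
      real (Suc m) * ((real N + 2) * real (alpha0_coeff N m (Suc m)))"
    unfolding mult.left_commute[of "real (Suc m)"] a b by (simp add: mult_ac add_ac)
  then show ?thesis by (rule mult_left_le_imp_le) simp
qed

text \<open>The right-hand side is the leading coefficient for \<alpha> = 1, with the same
  normaliser. By Pascal it exceeds the left one by \<open>N choose (m - 1)\<close> when
  \<open>0 < m\<close>, and equals it when \<open>m = 0\<close>.\<close>

lemma alpha0_coeff_lead_le: "alpha0_coeff N m (Suc m) \<le> (N + 2) choose Suc m"
  by (cases m) (simp_all add: alpha0_coeff_def)

section \<open>Both bounds for monomials\<close>

lemma genuine_alpha_BD_monomial_convex:
  assumes "1 \<le> n" "0 \<le> \<alpha>" "\<alpha> \<le> 1"
  obtains a where "\<And>j. 0 \<le> a j" "sum a {..p} = 1" "real n * (1 - a p) \<le> real p * (real p - 1)"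
    "\<And>z. genuine_alpha_BD n \<alpha> (\<lambda>w. w ^ p) z = (\<Sum>j\<le>p. of_real (a j) * z ^ j)"
proof -
  consider (1) "n = 1" | (0) N where "n = N + 2" "p = 0" | (Suc) N m where "n = N + 2" "p = Suc m"
  proof -
    have "n = 1 \<or> n = (n - 2) + 2" using assms(1) by auto
    then show thesis using that by (cases p) blast+
  qed
  then show thesis
  proof cases
    case 1
    \<comment> \<open>For \<open>n = 1\<close> the image of the monomial is
      \<open>0 ^ p * (1 - z) + z\<close>, that is \<open>1\<close> for \<open>p = 0\<close> and
      \<open>z\<close> otherwise.\<close>
    let ?a = "\<lambda>j. if j = min p 1 then 1 else 0 :: real"
    show ?thesis
    proof (rule that[of ?a])
      show "real n * (1 - ?a p) \<le> real p * (real p - 1)"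
      proof (cases "p \<le> 1")
        case False
        then have "1 * 1 \<le> real p * (real p - 1)" by (intro mult_mono) auto
        then show ?thesis using 1 False by simp
      qed (auto simp: le_Suc_eq)
      show "genuine_alpha_BD n \<alpha> (\<lambda>w. w ^ p) z = (\<Sum>j\<le>p. of_real (?a j) * z ^ j)" for z
        unfolding genuine_alpha_BD_def alpha_bernstein_def if_distrib[of of_real] if_distribR
        using 1 by (cases p) (simp_all add: if_distrib[of "\<lambda>x. x * _"] cong: if_cong)
    qed auto
  next
    case 0
    show ?thesis
    \<comment> \<open>Constants are reproduced, since the \<alpha>-Bernstein polynomials sum to
      1.\<close>
    proof (rule that[of "\<lambda>_. 1"])
      show "genuine_alpha_BD n \<alpha> (\<lambda>w. w ^ p) z = (\<Sum>j\<le>p. of_real 1 * z ^ j)" for z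
        unfolding genuine_alpha_BD_monomial[OF assms(1)]
        using sum_alpha_bernstein[of \<alpha> N z "\<lambda>_. 1"] sum_Bernstein_binomial[of N z 0]
          sum_Bernstein_binomial[of "N + 2" z 0] 0
        by (simp del: sum.atMost_Suc)
    qed (use 0 in auto)
  next
    case Suc
    \<comment> \<open>\<open>D\<close> is the common denominator
      \<open>(n + p - 1) choose p\<close>, and \<open>a1\<close> holds the unnormalised coefficients
      for \<alpha> = 1. The weights \<open>a\<close> interpolate linearly in \<alpha>.\<close>
    define D where "D = real ((N + m + 2) choose Suc m)"
    define a1 where "a1 j = ((N + 2) choose j) * (m choose (Suc m - j))" for j
    define a where "a j = ((1 - \<alpha>) * real (alpha0_coeff N m j) + \<alpha> * real (a1 j)) / D" for j
    have "D > 0" unfolding D_def of_nat_0_less_iff by (rule zero_less_binomial) simp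
    show ?thesis
    proof (rule that[of a])
      show "0 \<le> a j" for j using assms \<open>D > 0\<close> by (simp add: a_def)
      have "(\<Sum>j\<le>Suc m. real (alpha0_coeff N m j)) = D"
        unfolding D_def sum_alpha0_coeff_1[symmetric] by (simp only: of_nat_sum)
      moreover have "(\<Sum>j\<le>Suc m. real (a1 j)) = D"
        unfolding D_def a1_def of_nat_sum[symmetric] vandermonde by (simp add: add_ac)
      ultimately show "sum a {..p} = 1"
        using \<open>D > 0\<close> unfolding a_def Suc sum_divide_distrib[symmetric] sum.distrib sum_distrib_left[symmetric]
        by (simp add: algebra_simps del: sum.atMost_Suc)
      have "real (alpha0_coeff N m (Suc m)) \<le> real (a1 (Suc m))"
        using alpha0_coeff_lead_le[of N m] by (simp add: a1_def)
      \<comment> \<open>A weighted mean is at least its smaller entry, so \<alpha> = 0 is the worst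
        case.\<close>
      from mult_left_mono[OF this assms(2)] have "real (alpha0_coeff N m (Suc m)) \<le>
          (1 - \<alpha>) * real (alpha0_coeff N m (Suc m)) + \<alpha> * real (a1 (Suc m))"
        by (simp add: left_diff_distrib)
      then have "(real N + 2) * real (alpha0_coeff N m (Suc m)) \<le> (real N + 2) * (a p * D)"
        using \<open>D > 0\<close> by (intro mult_left_mono) (simp_all add: a_def Suc)
      then have "(real N + 2 - real (Suc m) * real m) * D \<le> (real N + 2) * a p * D"
        using alpha0_coeff_lead[of N m] unfolding D_def by linarith
      then have "real N + 2 - real (Suc m) * real m \<le> (real N + 2) * a p"
        using \<open>D > 0\<close> by simp
      then show "real n * (1 - a p) \<le> real p * (real p - 1)"
        by (simp add: Suc algebra_simps)
      show "genuine_alpha_BD n \<alpha> (\<lambda>w. w ^ p) z = (\<Sum>j\<le>p. of_real (a j) * z ^ j)" for z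
      proof -
        \<comment> \<open>The values to be summed are \<open>(k + m) choose Suc m\<close>; in the
          index-shifted sum \<open>m\<close> becomes \<open>m + 2\<close>.\<close>
        have "genuine_alpha_BD n \<alpha> (\<lambda>w. w ^ p) z =
            ((1 - of_real \<alpha>) * (\<Sum>j\<le>Suc m. of_nat (alpha0_coeff N m j) * z ^ j) +
             of_real \<alpha> * (\<Sum>j\<le>Suc m. of_nat (a1 j) * z ^ j)) / of_real D"
          using genuine_alpha_BD_monomial[of "N + 2" \<alpha> "Suc m" z]
            sum_alpha_bernstein[of \<alpha> N z "\<lambda>k. of_nat ((k + m) choose Suc m)"]
            sum_Bernstein_binomial_shift[of N z m "Suc m"]
            sum_Bernstein_binomial_shift[of N z "m + 2" "Suc m"]
            sum_Bernstein_binomial_shift[of "N + 2" z m "Suc m"]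
          unfolding sum_alpha0_coeff a1_def of_nat_mult Suc D_def
          by (simp add: add_ac del: sum.atMost_Suc binomial_Suc_Suc)
        moreover have "of_real (a j) * z ^ j =
            ((1 - of_real \<alpha>) * (of_nat (alpha0_coeff N m j) * z ^ j) +
              of_real \<alpha> * (of_nat (a1 j) * z ^ j)) / of_real D" for j
          by (simp add: a_def distrib_right mult.assoc)
        ultimately show ?thesis
          by (simp only: Suc sum_divide_distrib[symmetric] sum.distrib sum_distrib_left[symmetric])
      qed
    qed
  qed
qed

lemma norm_genuine_alpha_BD_monomial_le:
  assumes "1 \<le> n" "0 \<le> \<alpha>" "\<alpha> \<le> 1" "1 \<le> r" "norm z \<le> r"
  shows "norm (genuine_alpha_BD n \<alpha> (\<lambda>w. w ^ p) z) \<le> r ^ p"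
    and "norm (genuine_alpha_BD n \<alpha> (\<lambda>w. w ^ p) z - z ^ p) \<le>
      2 * (real p * (real p - 1)) * r ^ p / real n"
proof -
  obtain a where a: "\<And>j. 0 \<le> a j" "sum a {..p} = 1" "real n * (1 - a p) \<le> real p * (real p - 1)"
    "\<And>z. genuine_alpha_BD n \<alpha> (\<lambda>w. w ^ p) z = (\<Sum>j\<le>p. of_real (a j) * z ^ j)"
    using genuine_alpha_BD_monomial_convex[OF assms(1-3)] by metis
  note le = norm_convex_monomials_le[where a = a, OF a(1,2) assms(5,4)]
  show "norm (genuine_alpha_BD n \<alpha> (\<lambda>w. w ^ p) z) \<le> r ^ p"
    unfolding a(4) by (rule le)
  have "norm (genuine_alpha_BD n \<alpha> (\<lambda>w. w ^ p) z - z ^ p) \<le> 2 * (1 - a p) * r ^ p"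
    unfolding a(4) by (rule le)
  also have "1 - a p \<le> real p * (real p - 1) / real n"
    using a(3) assms(1) by (simp add: field_simps)
  then have "2 * (1 - a p) * r ^ p \<le> 2 * (real p * (real p - 1) / real n) * r ^ p"
    using assms(4) by (intro mult_right_mono mult_left_mono) auto
  finally show "norm (genuine_alpha_BD n \<alpha> (\<lambda>w. w ^ p) z - z ^ p) \<le>
      2 * (real p * (real p - 1)) * r ^ p / real n"
    by simp
qed

section \<open>From monomials to power series\<close>

text \<open>On the unit interval the terms are dominated by
  \<open>norm (c p) * (n choose k)\<close>, so the Weierstrass test gives uniform convergence and
  the series may be integrated termwise.\<close>

lemma integral_Bernstein_powser_sums:
  fixes f :: "complex \<Rightarrow> complex"
  assumes c: "summable (\<lambda>p. norm (c p))"
    and f: "\<And>t. 0 \<le> t \<Longrightarrow> t \<le> 1 \<Longrightarrow> (\<lambda>p. c p * of_real t ^ p) sums f (of_real t)"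
  shows "(\<lambda>p. c p * integral {0..1} (\<lambda>t. of_real (Bernstein n k t) * of_real t ^ p)) sums
    integral {0..1} (\<lambda>t. of_real (Bernstein n k t) * f (of_real t))"
proof -
  let ?B = "\<lambda>t. complex_of_real (Bernstein n k t)"
  have "uniform_limit {0..1} (\<lambda>N t. \<Sum>p<N. c p * (?B t * of_real t ^ p))
      (\<lambda>t. \<Sum>p. c p * (?B t * of_real t ^ p)) sequentially"
  proof (rule Weierstrass_m_test)
    show "summable (\<lambda>p. norm (c p) * real (n choose k))"
      using c by (rule summable_mult2)
    fix p and t :: real assume t: "t \<in> {0..1}"
    have "\<bar>Bernstein n k t\<bar> * \<bar>t\<bar> ^ p \<le> real (n choose k) * 1 * 1 * 1"
      unfolding Bernstein_def abs_mult power_abs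
      by (intro mult_mono) (use t in \<open>auto intro!: power_le_one\<close>)
    then show "norm (c p * (?B t * of_real t ^ p)) \<le> norm (c p) * real (n choose k)"
      by (simp add: norm_mult norm_power mult_left_mono)
  qed
  moreover have "(\<Sum>p. c p * (?B t * of_real t ^ p)) = ?B t * f (of_real t)" if "t \<in> {0..1}" for t
    using sums_mult[OF f[of t], of "?B t"] that by (simp add: sums_iff mult_ac)
  ultimately have u: "uniform_limit {0..1} (\<lambda>N t. \<Sum>p<N. c p * (?B t * of_real t ^ p))
      (\<lambda>t. ?B t * f (of_real t)) sequentially"
    by (subst uniform_limit_cong'[where g = "\<lambda>N t. \<Sum>p<N. c p * (?B t * of_real t ^ p)"
          and i = "\<lambda>t. \<Sum>p. c p * (?B t * of_real t ^ p)"]) auto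
  have cont: "continuous_on {0..1} (\<lambda>t. ?B t * of_real t ^ p)" for p
    unfolding Bernstein_def by (intro continuous_intros)
  obtain I J where I: "\<And>N. ((\<lambda>t. \<Sum>p<N. c p * (?B t * of_real t ^ p)) has_integral I N) {0..1}"
    and J: "((\<lambda>t. ?B t * f (of_real t)) has_integral J) {0..1}" and IJ: "I \<longlonglongrightarrow> J"
    by (rule uniform_limit_integral[OF u]) (auto intro!: continuous_on_sum continuous_on_mult_left cont)
  have "((\<lambda>t. \<Sum>p<N. c p * (?B t * of_real t ^ p)) has_integral
      (\<Sum>p<N. c p * integral {0..1} (\<lambda>t. ?B t * of_real t ^ p))) {0..1}" for N
    by (intro has_integral_sum has_integral_mult_right integrable_integral
        integrable_continuous_real cont) auto
  \<comment> \<open>\<open>uniform_limit_integral\<close> only provides some values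
    \<open>I N\<close>; uniqueness identifies them.\<close>
  then have "I = (\<lambda>N. \<Sum>p<N. c p * integral {0..1} (\<lambda>t. ?B t * of_real t ^ p))"
    using I by (intro ext) (rule has_integral_unique)
  then show ?thesis
    using IJ integral_unique[OF J] by (simp add: sums_def)
qed

lemma genuine_alpha_BD_sums:
  assumes c: "summable (\<lambda>p. norm (c p))"
    and f: "\<And>t. 0 \<le> t \<Longrightarrow> t \<le> 1 \<Longrightarrow> (\<lambda>p. c p * of_real t ^ p) sums f (of_real t)"
  shows "(\<lambda>p. c p * genuine_alpha_BD n \<alpha> (\<lambda>w. w ^ p) z) sums genuine_alpha_BD n \<alpha> f z"
proof -
  have "(\<lambda>p. alpha_bernstein \<alpha> n 0 z * (c p * 0 ^ p) + alpha_bernstein \<alpha> n n z * (c p * 1 ^ p) +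
      (of_nat n - 1) * (\<Sum>k = 1..n - 1. alpha_bernstein \<alpha> n k z *
        (c p * integral {0..1} (\<lambda>t. of_real (Bernstein (n - 2) (k - 1) t) * of_real t ^ p))))
      sums genuine_alpha_BD n \<alpha> f z"
    unfolding genuine_alpha_BD_def
    using f[of 0] f[of 1]
    by (intro sums_add sums_mult sums_sum integral_Bernstein_powser_sums[OF c f]) auto
  then show ?thesis
    unfolding genuine_alpha_BD_def by (simp add: algebra_simps sum_distrib_left)
qed

text \<open>Up to the factor \<open>r ^ 2\<close> and an index shift by 2, this is the absolute
  series of the second derivative, which converges inside the same disc.\<close>

lemma powser_second_derivative_norm_summable:
  fixes c :: "nat \<Rightarrow> complex"
  assumes "\<And>z. norm z < R \<Longrightarrow> summable (\<lambda>p. c p * z ^ p)" "0 \<le> r" "r < R"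
  shows "summable (\<lambda>p. norm (c p) * real p * (real p - 1) * r ^ p)"
proof -
  \<comment> \<open>Convergence at a point strictly between \<open>r\<close> and \<open>R\<close>
    gives absolute convergence at \<open>r\<close>.\<close>
  define x where "x = (r + R) / 2"
  have x: "r < x" "x < R" "0 < x" using assms(2,3) by (auto simp: x_def)
  have "summable (\<lambda>p. diffs (diffs c) p * of_real x ^ p)"
    by (rule termdiff_converges[where K = R], use x in simp)
      (rule termdiff_converges[where K = R], use assms(1) in auto)
  then have "summable (\<lambda>p. norm (diffs (diffs c) p * of_real r ^ p))"
    by (rule powser_insidea) (use x assms(2) in simp)
  then have "summable (\<lambda>p. r ^ 2 * norm (diffs (diffs c) p * of_real r ^ p))"
    by (rule summable_mult)
  also have "(\<lambda>p. r ^ 2 * norm (diffs (diffs c) p * of_real r ^ p)) =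
      (\<lambda>p. norm (c (p + 2)) * real (p + 2) * (real (p + 2) - 1) * r ^ (p + 2))"
  proof
    fix p
    have "norm (1 + of_nat p :: complex) = 1 + real p" "norm (2 + of_nat p :: complex) = 2 + real p"
      using norm_of_nat[of "1 + p", where 'a = complex] norm_of_nat[of "2 + p", where 'a = complex]
      by simp_all
    then show "r ^ 2 * norm (diffs (diffs c) p * of_real r ^ p) =
      norm (c (p + 2)) * real (p + 2) * (real (p + 2) - 1) * r ^ (p + 2)"
      using assms(2) by (simp add: diffs_def norm_mult norm_power power_add power2_eq_square mult_ac)
  qed
  finally show ?thesis by (subst (asm) summable_iff_shift)
qed

theorem theorem1:
  "(\<forall>(p::nat) (n::nat) (\<alpha>::real) (r::real) (z::complex).
      1 \<le> n \<longrightarrow> 0 \<le> \<alpha> \<longrightarrow> \<alpha> \<le> 1 \<longrightarrow> 1 \<le> r \<longrightarrow> norm z \<le> r \<longrightarrow>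
        norm (genuine_alpha_BD n \<alpha> (\<lambda>w. w ^ p) z) \<le> r ^ p)
   \<and>
   (\<forall>(R::real) (f::complex \<Rightarrow> complex) (c::nat \<Rightarrow> complex) (r::real).
      1 < R \<longrightarrow> (\<forall>z. norm z < R \<longrightarrow> (\<lambda>p. c p * z ^ p) sums f z) \<longrightarrow> 1 \<le> r \<longrightarrow> r < R \<longrightarrow>
        (\<lambda>p. norm (c p) * real p * (real p - 1) * r ^ p) summable_on {2..} \<and>
        (\<forall>(z::complex) (n::nat) (\<alpha>::real).
           norm z \<le> r \<longrightarrow> 1 \<le> n \<longrightarrow> 0 \<le> \<alpha> \<longrightarrow> \<alpha> \<le> 1 \<longrightarrow>
             norm (genuine_alpha_BD n \<alpha> f z - f z)
               \<le> (2 * (\<Sum>\<^sub>\<infinity>p\<in>{2..}. norm (c p) * real p * (real p - 1) * r ^ p)) / real n))"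
proof (intro conjI allI impI)
  fix p n :: nat and \<alpha> r :: real and z :: complex
  assume "1 \<le> n" "0 \<le> \<alpha>" "\<alpha> \<le> 1" "1 \<le> r" "norm z \<le> r"
  then show "norm (genuine_alpha_BD n \<alpha> (\<lambda>w. w ^ p) z) \<le> r ^ p"
    by (rule norm_genuine_alpha_BD_monomial_le)
next
  fix R r :: real and f :: "complex \<Rightarrow> complex" and c :: "nat \<Rightarrow> complex"
  assume R: "1 < R" and f: "\<forall>z. norm z < R \<longrightarrow> (\<lambda>p. c p * z ^ p) sums f z" and r: "1 \<le> r" "r < R"
  define u where "u p = norm (c p) * real p * (real p - 1) * r ^ p" for p
  have summable_c: "summable (\<lambda>p. c p * z ^ p)" if "norm z < R" for z
    using f that by (auto simp: sums_iff)
  have u: "summable u"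
    unfolding u_def by (rule powser_second_derivative_norm_summable[OF summable_c]) (use r in auto)
  have u_nonneg: "0 \<le> u p" for p
    using r by (cases p) (auto simp: u_def)
  have "(u has_sum suminf u) UNIV"
    using u u_nonneg by (intro sums_nonneg_imp_has_sum summable_sums)
  \<comment> \<open>The series over all \<open>p\<close> and the sum over \<open>{2..}\<close>
    agree.\<close>
  moreover have "u p = 0" if "p \<notin> {2..}" for p
  proof -
    have "p = 0 \<or> p = 1" using that by auto
    then show ?thesis by (auto simp: u_def)
  qed
  ultimately have has_sum: "(u has_sum suminf u) {2..}"
    by (subst has_sum_cong_neutral[of UNIV _ u u]) auto
  then show "(\<lambda>p. norm (c p) * real p * (real p - 1) * r ^ p) summable_on {2..}"
    by (auto simp: u_def[abs_def] summable_on_def)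
  \<comment> \<open>Convergence at \<open>(1 + R) / 2 > 1\<close> gives absolute convergence at 1,
    as termwise integration requires.\<close>
  have c: "summable (\<lambda>p. norm (c p))"
  proof -
    have "norm (of_real ((1 + R) / 2) :: complex) = (1 + R) / 2"
      using R unfolding norm_of_real by simp
    then show ?thesis
      using powser_insidea[OF summable_c[of "of_real ((1 + R) / 2)"], of 1] R by simp
  qed
  fix z :: complex and n :: nat and \<alpha> :: real
  assume z: "norm z \<le> r" and n: "1 \<le> n" and \<alpha>: "0 \<le> \<alpha>" "\<alpha> \<le> 1"
  have "(\<lambda>p. c p * genuine_alpha_BD n \<alpha> (\<lambda>w. w ^ p) z) sums genuine_alpha_BD n \<alpha> f z"
    by (rule genuine_alpha_BD_sums[OF c]) (use f R in auto)
  moreover have "(\<lambda>p. c p * z ^ p) sums f z" using f z r by auto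
  ultimately have "(\<lambda>p. c p * (genuine_alpha_BD n \<alpha> (\<lambda>w. w ^ p) z - z ^ p)) sums
      (genuine_alpha_BD n \<alpha> f z - f z)"
    unfolding right_diff_distrib by (rule sums_diff)
  then have "genuine_alpha_BD n \<alpha> f z - f z =
      (\<Sum>p. c p * (genuine_alpha_BD n \<alpha> (\<lambda>w. w ^ p) z - z ^ p))"
    by (simp add: sums_iff)
  also have "norm \<dots> \<le> (\<Sum>p. 2 / real n * u p)"
  proof (rule norm_suminf_le)
    \<comment> \<open>The monomial error bound, weighted by \<open>norm (c p)\<close>, is exactly
      this majorant.\<close>
    show "norm (c p * (genuine_alpha_BD n \<alpha> (\<lambda>w. w ^ p) z - z ^ p)) \<le> 2 / real n * u p" for p
      using mult_left_mono[OF norm_genuine_alpha_BD_monomial_le(2)[OF n \<alpha> r(1) z, of p], of "norm (c p)"]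
      by (simp add: norm_mult u_def mult_ac)
    show "summable (\<lambda>p. 2 / real n * u p)" using u by (rule summable_mult)
  qed
  also have "\<dots> = 2 * suminf u / real n" using suminf_mult[OF u, of "2 / real n"] by simp
  also have "suminf u = (\<Sum>\<^sub>\<infinity>p\<in>{2..}. norm (c p) * real p * (real p - 1) * r ^ p)"
    using infsumI[OF has_sum] by (simp add: u_def[abs_def])
  finally show "norm (genuine_alpha_BD n \<alpha> f z - f z) \<le>
      2 * (\<Sum>\<^sub>\<infinity>p\<in>{2..}. norm (c p) * real p * (real p - 1) * r ^ p) / real n" .
qed

end
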